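(* Let the discrete solution at time level $n$ be admissible: $\rho^n(\vec\xi_{ijk})>0$ and $\mathrm{IE}({\bf U}^n(\vec\xi_{ijk}))>0$ at all (finitely many) solution points of the domain. Let the solution be advanced by the explicit Euler method $\hat{\bf U}^{n+1}=\hat{\bf U}^n+\tau\,\hat{\bf U}_t$, where $\hat{\bf U}_t$ is given by the semi-discrete first-order finite volume scheme $$\hat{\bf U}_t=-\sum_{l=1}^3\mathcal P_{\xi^l}^{-1}\Delta_{\xi^l}\left[\hat{\bar{\bf f}}^{(in)}_l-\hat{\bar{\bf f}}^{(AD_1)}_{\hat{\bar\sigma},l}-\hat{\bar{\bf f}}^{(AD_1)}_l\right]+\sum_{l=1}^3D_{\xi^l}\hat{\bf f}^{(v)}_l+\sum_{l=1}^3\mathcal P_{\xi^l}^{-1}\left[\hat{\bf g}_l+\hat{\bf g}^{(AD_1)}_l\right]$$ evaluated at time level $n$, with interface mass diffusion satisfying the density positivity condition $\mathscr D_l^{\pm}\ge|\hat m_l^\pm|/(2\rho^\pm_{l,A})$, and let $\tau^\rho>0$ be the corresponding density positivity bound $$\tau^\rho=\min_{ijk}\frac{J_{ijk}}{2\sum_{l=1}^3(\mathscr D^+_l+\mathscr D^-_l)/P_l}.$$ Then there exists $\tau^{\min}\in(0,\tau^\rho]$ such that for all $\tau$ with $0<\tau<\tau^{\min}$ the scheme preserves positivity of internal energy: $\mathrm{IE}({\bf U}^{n+1}(\vec\xi_{ijk}))>0$ at every solution point.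
   Context: Each hexahedral element carries an $N\times N\times N$ tensor-product grid of Legendre-Gauss-Lobatto solution points $\vec\xi_{ijk}$; $\mathcal P_{i,i}>0$ are the LGL weights, $P_1=\mathcal P_{i,i}$, $P_2=\mathcal P_{j,j}$, $P_3=\mathcal P_{k,k}$, $J_{ijk}>0$ is the mapping Jacobian, and $\hat{\bf U}(\vec\xi_{ijk})=J_{ijk}{\bf U}(\vec\xi_{ijk})$ with ${\bf U}=(\rho,{\bm m},\mathcal E)$: density, momentum ${\bm m}=\rho\vec V$, and total energy per unit volume $\mathcal E=\rho E$. Internal energy: $\mathrm{IE}({\bf U})=\mathcal E-\frac{\|{\bm m}\|^2}{2\rho}$. The Jacobian is time independent. In the scheme, $\mathcal P_{\xi^l}$ is the tensor-product mass matrix in direction $l$, $\Delta_{\xi^l}$ is the backward difference of flux-point values in direction $l$, and $D_{\xi^l}$ is the LGL spectral collocation derivative. $\hat{\bar{\bf f}}^{(in)}_l$ is the two-point inviscid flux (entropy conservative minus entropy dissipative part), $\hat{\bar{\bf f}}^{(AD_1)}_l$ and $\hat{\bar{\bf f}}^{(AD_1)}_{\hat{\bar\sigma},l}$ are first-order two-point artificial dissipation fluxes (the latter purely mass diffusion), $\hat{\bf f}^{(v)}_l$ are the Navier-Stokes viscous fluxes (zero mass component), and $\hat{\bf g}_l,\hat{\bf g}^{(AD_1)}_l$ are interface penalties coupling neighbouring elements. Given an admissible solution at level $n$, all these are well-defined finite vectors. Density part: the density update at $\vec\xi_{ijk}$ takes the form $J_{ijk}\rho^{n+1}_{ijk}=J_{ijk}\rho^n_{ijk}-\tau\sum_{l=1}^3(\hat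 f^{\rho+}_l-\hat f^{\rho-}_l)/P_l$, where the mass fluxes at the "$\pm$" faces in direction $l$ are $\hat f^{\rho\pm}_l=\hat m^\pm_l-\mathscr D^\pm_l\Delta^\pm_l\rho$, with $\Delta^+_l\rho$ the neighbour's density at the $+$ side minus that at the point, $\Delta_l^-\rho$ the density at the point minus that of the neighbour at the $-$ side, and $\rho^\pm_{l,A}$ the arithmetic average of the two densities. If all $\mathscr D^\pm_l$ vanish, $\tau^\rho=+\infty$, and then $\tau^{\min}=+\infty$ is allowed. *)

theory Defs
  imports "HOL-Analysis.Analysis" "HOL-Computational_Algebra.Polynomial"
begin

section \<open>Conservative variables\<close>

text \<open>A state is the triple (density, momentum, total energy per unit volume). Flux vectors have
  the same type, their first component being the mass flux.\<close>

type_synonym state = "real \<times> (real ^ 3) \<times> real"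

definition mass_density :: "state \<Rightarrow> real" where
  "mass_density u = fst u"

definition momentum :: "state \<Rightarrow> real ^ 3" where
  "momentum u = fst (snd u)"

definition total_energy :: "state \<Rightarrow> real" where
  "total_energy u = snd (snd u)"

definition internal_energy :: "state \<Rightarrow> real" where
  "internal_energy u = total_energy u - (norm (momentum u))\<^sup>2 / (2 * mass_density u)"

section \<open>Legendre-Gauss-Lobatto collocation in one dimension\<close>

text \<open>Rodrigues' formula.\<close>

definition legendre :: "nat \<Rightarrow> real poly" where
  "legendre n = smult (1 / (2 ^ n * fact n)) ((pderiv ^^ n) ([:-1, 0, 1:] ^ n))"

text \<open>The \<open>N\<close> nodes are the endpoints \<open>-1\<close>, \<open>1\<close> together with the zeros of the derivative of
  the Legendre polynomial of degree \<open>N - 1\<close>. They are numbered \<open>1, \<dots>, N\<close> from left to right.\<close>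

definition lgl_node :: "nat \<Rightarrow> nat \<Rightarrow> real" where
  "lgl_node N i =
     sorted_list_of_set {x. poly ([:-1, 0, 1:] * pderiv (legendre (N - 1))) x = 0} ! (i - 1)"

definition lgl_weight :: "nat \<Rightarrow> nat \<Rightarrow> real" where
  "lgl_weight N i = 2 / (real N * (real N - 1) * (poly (legendre (N - 1)) (lgl_node N i))\<^sup>2)"

definition lgl_lagrange :: "nat \<Rightarrow> nat \<Rightarrow> real poly" where
  "lgl_lagrange N j =
     (\<Prod>m\<in>{1..N} - {j}. smult (1 / (lgl_node N j - lgl_node N m)) [:- lgl_node N m, 1:])"

definition lgl_deriv :: "nat \<Rightarrow> nat \<Rightarrow> nat \<Rightarrow> real" where
  "lgl_deriv N i j = poly (pderiv (lgl_lagrange N j)) (lgl_node N i)"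

section \<open>Grid and tensor-product operators\<close>

text \<open>The finite type \<open>'e\<close> indexes the hexahedral elements. A point is an element together with
  a multi-index \<open>(i, j, k)\<close>, seen as a function of the coordinate direction \<open>l :: 3\<close>. Solution
  points have all their indices in \<open>{1..N}\<close>.

  In direction \<open>l\<close> the flux points of a grid line have their \<open>l\<close>-th index in \<open>{0..N}\<close>: flux point
  \<open>s\<close> lies between the solution points \<open>s\<close> and \<open>s + 1\<close>, and the flux points \<open>0\<close> and \<open>N\<close> lie on
  the two opposite faces of the element.\<close>

type_synonym 'e point = "'e \<times> (3 \<Rightarrow> nat)"

definition points :: "nat \<Rightarrow> 'e point set" where
  "points N = {(e, i). \<forall>l. i l \<in> {1..N}}"

definition mass :: "nat \<Rightarrow> 3 \<Rightarrow> 'e point \<Rightarrow> real" where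
  "mass N l p = lgl_weight N (snd p l)"

definition mass_inv :: "nat \<Rightarrow> 3 \<Rightarrow> ('e point \<Rightarrow> state) \<Rightarrow> 'e point \<Rightarrow> state" where
  "mass_inv N l f p = f p /\<^sub>R mass N l p"

definition backward_diff :: "3 \<Rightarrow> ('e point \<Rightarrow> state) \<Rightarrow> 'e point \<Rightarrow> state" where
  "backward_diff l f = (\<lambda>(e, i). f (e, i) - f (e, i(l := i l - 1)))"

definition collocation_deriv :: "nat \<Rightarrow> 3 \<Rightarrow> ('e point \<Rightarrow> state) \<Rightarrow> 'e point \<Rightarrow> state" where
  "collocation_deriv N l f = (\<lambda>(e, i). \<Sum>s = 1..N. lgl_deriv N (i l) s *\<^sub>R f (e, i(l := s)))"

section \<open>The first-order scheme\<close>

text \<open>The fluxes and penalties are functions of the discrete solution. The inviscid and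
  artificial dissipation fluxes take values at the flux points of each direction, the viscous
  fluxes and the penalties at the solution points. No particular flux formula is fixed: metric
  terms, artificial viscosities and boundary data are absorbed in these functions. The inviscid
  flux is the difference of an entropy conservative and an entropy dissipative part.\<close>

record 'e fluxes =
  flux_ec :: "('e point \<Rightarrow> state) \<Rightarrow> 3 \<Rightarrow> 'e point \<Rightarrow> state"
  flux_ed :: "('e point \<Rightarrow> state) \<Rightarrow> 3 \<Rightarrow> 'e point \<Rightarrow> state"
  flux_ad_sigma :: "('e point \<Rightarrow> state) \<Rightarrow> 3 \<Rightarrow> 'e point \<Rightarrow> state"
  flux_ad :: "('e point \<Rightarrow> state) \<Rightarrow> 3 \<Rightarrow> 'e point \<Rightarrow> state"
  flux_visc :: "('e point \<Rightarrow> state) \<Rightarrow> 3 \<Rightarrow> 'e point \<Rightarrow> state"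
  penalty :: "('e point \<Rightarrow> state) \<Rightarrow> 3 \<Rightarrow> 'e point \<Rightarrow> state"
  penalty_ad :: "('e point \<Rightarrow> state) \<Rightarrow> 3 \<Rightarrow> 'e point \<Rightarrow> state"

definition flux_in :: "'e fluxes \<Rightarrow> ('e point \<Rightarrow> state) \<Rightarrow> 3 \<Rightarrow> 'e point \<Rightarrow> state" where
  "flux_in F U l p = flux_ec F U l p - flux_ed F U l p"

definition semi_discrete ::
    "nat \<Rightarrow> 'e fluxes \<Rightarrow> ('e point \<Rightarrow> state) \<Rightarrow> 'e point \<Rightarrow> state" where
  "semi_discrete N F U p =
     - (\<Sum>l\<in>UNIV. mass_inv N l
          (backward_diff l (\<lambda>q. flux_in F U l q - flux_ad_sigma F U l q - flux_ad F U l q)) p)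
     + (\<Sum>l\<in>UNIV. collocation_deriv N l (flux_visc F U l) p)
     + (\<Sum>l\<in>UNIV. mass_inv N l (\<lambda>q. penalty F U l q + penalty_ad F U l q) p)"

definition hat :: "('e point \<Rightarrow> real) \<Rightarrow> ('e point \<Rightarrow> state) \<Rightarrow> 'e point \<Rightarrow> state" where
  "hat J U p = J p *\<^sub>R U p"

text \<open>The update acts on \<open>hat J U\<close>. The new state is recovered by dividing by the time
  independent Jacobian \<open>J\<close>.\<close>

definition euler_step ::
    "nat \<Rightarrow> ('e point \<Rightarrow> real) \<Rightarrow> 'e fluxes \<Rightarrow> real \<Rightarrow> ('e point \<Rightarrow> state) \<Rightarrow> 'e point \<Rightarrow> state" where
  "euler_step N J F \<tau> U p = (hat J U p + \<tau> *\<^sub>R semi_discrete N F U p) /\<^sub>R J p"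

definition admissible :: "nat \<Rightarrow> ('e point \<Rightarrow> state) \<Rightarrow> bool" where
  "admissible N U \<longleftrightarrow> (\<forall>p\<in>points N. mass_density (U p) > 0 \<and> internal_energy (U p) > 0)"

section \<open>Density update\<close>

datatype side = Minus | Plus

text \<open>Inside an element the neighbour of a point is the adjacent point of the grid line. Across an
  element face it is the point given by the connectivity \<open>conn\<close>, or, where \<open>conn\<close> is
  \<open>None\<close> (domain boundary), an exterior state with density \<open>\<rho>b\<close>.\<close>

definition neighbour_density ::
    "nat \<Rightarrow> (side \<Rightarrow> 3 \<Rightarrow> 'e point \<Rightarrow> 'e point option) \<Rightarrow> (side \<Rightarrow> 3 \<Rightarrow> 'e point \<Rightarrow> real)
      \<Rightarrow> ('e point \<Rightarrow> state) \<Rightarrow> side \<Rightarrow> 3 \<Rightarrow> 'e point \<Rightarrow> real" where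
  "neighbour_density N conn \<rho>b U s l = (\<lambda>(e, i).
     if s = Plus \<and> i l < N then mass_density (U (e, i(l := i l + 1)))
     else if s = Minus \<and> 1 < i l then mass_density (U (e, i(l := i l - 1)))
     else (case conn s l (e, i) of
             Some q \<Rightarrow> mass_density (U q)
           | None \<Rightarrow> \<rho>b s l (e, i)))"

text \<open>Differences are always taken in the positive direction of the coordinate. In the two
  definitions below \<open>\<rho>nb\<close> is the density of the neighbour.\<close>

definition density_jump :: "side \<Rightarrow> real \<Rightarrow> real \<Rightarrow> real" where
  "density_jump s \<rho> \<rho>nb = (case s of Plus \<Rightarrow> \<rho>nb - \<rho> | Minus \<Rightarrow> \<rho> - \<rho>nb)"

definition density_avg :: "real \<Rightarrow> real \<Rightarrow> real" where
  "density_avg \<rho> \<rho>nb = (\<rho> + \<rho>nb) / 2"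

text \<open>A point where all the coefficients \<open>D\<close> vanish contributes \<open>\<infinity>\<close> to the minimum, because
  \<open>ereal a / 0 = \<infinity>\<close> for \<open>a > 0\<close>.\<close>

definition tau_rho ::
    "nat \<Rightarrow> ('e::finite point \<Rightarrow> real) \<Rightarrow> (side \<Rightarrow> 3 \<Rightarrow> 'e point \<Rightarrow> real) \<Rightarrow> ereal" where
  "tau_rho N J D =
     (MIN p\<in>points N. ereal (J p) / ereal (2 * (\<Sum>l\<in>UNIV. (D Plus l p + D Minus l p) / mass N l p)))"

end

theory Submission
  imports Defs
begin

text \<open>The internal energy is continuous wherever the density does not vanish. At a fixed point
  the Euler update is an affine, hence continuous, function of the step size and equals the old
  state for step size zero. Since the old internal energy is positive there, it stays positive for
  all small enough steps (\<open>euler_step_internal_energy_pos\<close>), and as there are only finitely many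
  points one threshold serves them all.

  The threshold can be cut down to the density bound because that bound is itself positive
  (\<open>tau_rho_pos\<close>): it is a minimum over finitely many points of a positive Jacobian divided by a
  nonnegative number, a zero divisor giving \<open>\<infinity>\<close>. The nonnegativity comes from the mass diffusion
  condition, whose right-hand side has the positive average density of two neighbours as its denominator.\<close>

lemma finite_points: "finite (points N :: 'e::finite point set)"
proof -
  have "points N = (UNIV :: 'e set) \<times> (\<Pi>\<^sub>E l\<in>(UNIV :: 3 set). {1..N})"
    by (auto simp: points_def PiE_def)
  then show ?thesis
    by (simp add: finite_PiE)
qed

lemma points_nonempty:
  assumes "N \<ge> 1"
  shows "points N \<noteq> {}"
proof -
  have "(undefined, \<lambda>_. 1) \<in> points N"
    using assms by (simp add: points_def)
  then show ?thesis by blast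
qed

text \<open>In the closed formula for the weights the value of the Legendre polynomial enters squared.\<close>

lemma mass_nonneg: "mass N l p \<ge> 0"
proof -
  have "real N * (real N - 1) \<ge> 0"
    by (cases N) auto
  then show ?thesis
    by (simp add: mass_def lgl_weight_def)
qed

text \<open>The neighbour is either a grid point of the same element, or a grid point of the adjacent
  element, or an exterior state; the first two have positive density by admissibility.\<close>

lemma neighbour_density_pos:
  assumes U: "admissible N U"
    and p: "p \<in> points N"
    and conn: "\<And>q. conn s l p = Some q \<Longrightarrow> q \<in> points N"
    and boundary: "conn s l p = None \<Longrightarrow> \<rho>b s l p > 0"
  shows "neighbour_density N conn \<rho>b U s l p > 0"
proof -
  obtain e i where p_eq: "p = (e, i)" by fastforce
  have pos: "mass_density (U q) > 0" if "q \<in> points N" for q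
    using U that by (simp add: admissible_def)
  have range: "1 \<le> i l" "i l \<le> N"
    using p by (auto simp: points_def p_eq)
  have inner: "mass_density (U (e, i(l := k))) > 0" if "k \<in> {1..N}" for k
    using p that by (intro pos) (auto simp: points_def p_eq)
  show ?thesis
    using range inner[of "i l + 1"] inner[of "i l - 1"] pos conn boundary
    by (cases "s = Plus \<and> i l < N"; cases "s = Minus \<and> 1 < i l")
      (auto simp: neighbour_density_def p_eq Suc_le_eq split: option.split)
qed

lemma tau_rho_pos:
  fixes J :: "'e::finite point \<Rightarrow> real"
  assumes "N \<ge> 1"
    and J: "\<And>p. p \<in> points N \<Longrightarrow> J p > 0"
    and D: "\<And>s l p. p \<in> points N \<Longrightarrow> D s l p \<ge> 0"
  shows "tau_rho N J D > 0"
proof -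
  have "ereal (J p) / ereal (2 * (\<Sum>l\<in>UNIV. (D Plus l p + D Minus l p) / mass N l p)) > 0"
    if p: "p \<in> points N" for p
  proof -
    define S where "S = 2 * (\<Sum>l\<in>UNIV. (D Plus l p + D Minus l p) / mass N l p)"
    have "S \<ge> 0"
      unfolding S_def using D[OF p] by (intro mult_nonneg_nonneg sum_nonneg) (auto simp: mass_nonneg)
    \<comment> \<open>For \<open>S = 0\<close> the extended quotient is \<open>\<infinity>\<close> because \<open>J p > 0\<close>.\<close>
    then have "ereal (J p) / ereal S > 0"
      using J[OF p] by (cases "S = 0") auto
    then show ?thesis by (simp add: S_def)
  qed
  then show ?thesis
    unfolding tau_rho_def
    by (subst Min_gr_iff)
      (simp_all add: finite_points points_nonempty[OF \<open>N \<ge> 1\<close>] del: ereal_divide)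
qed

lemma tendsto_internal_energy:
  assumes "(u \<longlongrightarrow> v) A" and "mass_density v \<noteq> 0"
  shows "((\<lambda>x. internal_energy (u x)) \<longlongrightarrow> internal_energy v) A"
  using assms unfolding internal_energy_def mass_density_def momentum_def total_energy_def
  by (intro tendsto_intros) auto

text \<open>The Jacobian cancels between \<open>hat\<close> and the final division, so the step tends to the old
  state itself.\<close>

lemma tendsto_euler_step:
  assumes "J p \<noteq> 0"
  shows "((\<lambda>\<tau>. euler_step N J F \<tau> U p) \<longlongrightarrow> U p) (at_right 0)"
proof -
  have "((\<lambda>\<tau>. euler_step N J F \<tau> U p) \<longlongrightarrow>
          (hat J U p + 0 *\<^sub>R semi_discrete N F U p) /\<^sub>R J p) (at_right 0)"
    unfolding euler_step_def by (intro tendsto_intros)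
  then show ?thesis
    using assms by (simp add: hat_def)
qed

lemma euler_step_internal_energy_pos:
  fixes U :: "'e::finite point \<Rightarrow> state"
  assumes J: "\<And>p. p \<in> points N \<Longrightarrow> J p > 0"
    and U: "admissible N U"
  shows "\<forall>\<^sub>F \<tau> in at_right 0. \<forall>p\<in>points N. internal_energy (euler_step N J F \<tau> U p) > 0"
proof (rule eventually_ball_finite[OF finite_points], intro ballI)
  fix p :: "'e point"
  assume p: "p \<in> points N"
  then have U_p: "mass_density (U p) > 0" "internal_energy (U p) > 0"
    using U by (auto simp: admissible_def)
  have "((\<lambda>\<tau>. internal_energy (euler_step N J F \<tau> U p)) \<longlongrightarrow> internal_energy (U p)) (at_right 0)"
    using U_p J[OF p] by (intro tendsto_internal_energy tendsto_euler_step) auto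
  then show "\<forall>\<^sub>F \<tau> in at_right 0. internal_energy (euler_step N J F \<tau> U p) > 0"
    using U_p(2) by (rule order_tendstoD(1))
qed

theorem lemma6:
  fixes N :: nat
    and J :: "'e::finite point \<Rightarrow> real"
    and F :: "'e fluxes"
    and U :: "'e point \<Rightarrow> state"
    and conn :: "side \<Rightarrow> 3 \<Rightarrow> 'e point \<Rightarrow> 'e point option"
    and \<rho>b mhat D f\<rho> \<rho>nb :: "side \<Rightarrow> 3 \<Rightarrow> 'e point \<Rightarrow> real"
  defines "\<rho>nb \<equiv> neighbour_density N conn \<rho>b U"
    and "f\<rho> \<equiv> (\<lambda>s l p. mhat s l p - D s l p * density_jump s (mass_density (U p)) (\<rho>nb s l p))"
  assumes N: "N \<ge> 2"
    and J_pos: "\<And>p. p \<in> points N \<Longrightarrow> J p > 0"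
    and admissible: "admissible N U"
    and conn: "\<And>s l p q. p \<in> points N \<Longrightarrow> conn s l p = Some q \<Longrightarrow> q \<in> points N"
    and boundary: "\<And>s l p. p \<in> points N \<Longrightarrow> conn s l p = None \<Longrightarrow> \<rho>b s l p > 0"
    and visc_mass: "\<And>l p. p \<in> points N \<Longrightarrow> mass_density (flux_visc F U l p) = 0"
    and density_update: "\<And>\<tau> p. \<tau> > 0 \<Longrightarrow> p \<in> points N \<Longrightarrow>
          J p * mass_density (euler_step N J F \<tau> U p) =
          J p * mass_density (U p) - \<tau> * (\<Sum>l\<in>UNIV. (f\<rho> Plus l p - f\<rho> Minus l p) / mass N l p)"
    and mass_diffusion: "\<And>s l p. p \<in> points N \<Longrightarrow>
          D s l p \<ge> \<bar>mhat s l p\<bar> / (2 * density_avg (mass_density (U p)) (\<rho>nb s l p))"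
  shows "\<exists>\<tau>min::ereal. 0 < \<tau>min \<and> \<tau>min \<le> tau_rho N J D \<and>
          (\<forall>\<tau>::real. 0 < \<tau> \<and> ereal \<tau> < \<tau>min \<longrightarrow>
             (\<forall>p\<in>points N. internal_energy (euler_step N J F \<tau> U p) > 0))"
proof -
  have D_nonneg: "D s l p \<ge> 0" if p: "p \<in> points N" for s l p
  proof -
    have "mass_density (U p) > 0"
      using admissible p by (simp add: admissible_def)
    moreover have "\<rho>nb s l p > 0"
      unfolding \<rho>nb_def using neighbour_density_pos[OF admissible p] conn[OF p] boundary[OF p] by blast
    ultimately have "\<bar>mhat s l p\<bar> / (2 * density_avg (mass_density (U p)) (\<rho>nb s l p)) \<ge> 0"
      by (simp add: density_avg_def)
    then show ?thesis
      using mass_diffusion[OF p] by (rule order_trans)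
  qed
  obtain \<delta> where "\<delta> > 0"
    and \<delta>: "\<And>\<tau>. 0 < \<tau> \<Longrightarrow> \<tau> < \<delta> \<Longrightarrow> \<forall>p\<in>points N. internal_energy (euler_step N J F \<tau> U p) > 0"
    using euler_step_internal_energy_pos[where J = J and F = F, OF J_pos admissible]
    unfolding eventually_at_right_field by blast
  have "tau_rho N J D > 0"
    using N J_pos D_nonneg by (intro tau_rho_pos) auto
  with \<open>\<delta> > 0\<close> have "0 < min (tau_rho N J D) (ereal \<delta>)"
    by simp
  moreover have "\<forall>\<tau>::real. 0 < \<tau> \<and> ereal \<tau> < min (tau_rho N J D) (ereal \<delta>) \<longrightarrow>
      (\<forall>p\<in>points N. internal_energy (euler_step N J F \<tau> U p) > 0)"
    using \<delta> by simp
  ultimately show ?thesis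
    by (intro exI[of _ "min (tau_rho N J D) (ereal \<delta>)"]) auto
qed

end
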